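(* Let $A,B\in\mathbb{C}^{m\times n}$ with $\operatorname{rank}(A)=r\ge 1$ and $\operatorname{rank}(B)=s\ge 1$, and let $E=B-A$ and $\widetilde{E}=B^{\dagger}-A^{\dagger}$. Define \[ \beta_{1}:=\min\Big\{\|A^{\dagger}\|_{2}^{2}\big(\|E\|_{F}^{2}-\|BB^{\dagger}E\|_{F}^{2}\big),\ \|A\|_{2}^{2}\big(\|\widetilde{E}\|_{F}^{2}-\|\widetilde{E}BB^{\dagger}\|_{F}^{2}\big)\Big\}, \] \[ \beta_{2}:=\min\Big\{\|B^{\dagger}\|_{2}^{2}\big(\|E\|_{F}^{2}-\|AA^{\dagger}E\|_{F}^{2}\big),\ \|B\|_{2}^{2}\big(\|\widetilde{E}\|_{F}^{2}-\|\widetilde{E}AA^{\dagger}\|_{F}^{2}\big)\Big\}. \] Then \[ \|P_{B}-P_{A}\|_{F}^{2}\leq\beta_{1}+\beta_{2}. \] In particular, if $s=r$, then \[ \|P_{B}-P_{A}\|_{F}^{2}\leq 2\min\{\beta_{1},\beta_{2}\}. \]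
   Context: For a complex matrix $M$: $M^{\dagger}$ is the Moore--Penrose inverse, $\|M\|_{F}$ the Frobenius norm, $\|M\|_{2}$ the spectral norm, and $P_{M}=MM^{\dagger}$ the orthogonal projection onto the column space of $M$. *)

theory Defs
  imports "HOL-Analysis.Analysis"
begin

definition conj_transpose :: "complex^'n^'m \<Rightarrow> complex^'m^'n" where
  "conj_transpose M = map_matrix cnj (transpose M)"

definition is_mp_inverse :: "complex^'n^'m \<Rightarrow> complex^'m^'n \<Rightarrow> bool" where
  "is_mp_inverse M X \<longleftrightarrow>
     M ** X ** M = M \<and> X ** M ** X = X \<and>
     conj_transpose (M ** X) = M ** X \<and> conj_transpose (X ** M) = X ** M"

(* Existence and uniqueness, which make this description proper, are mp_inverse_ex1 below. *)
definition mp_inverse :: "complex^'n^'m \<Rightarrow> complex^'m^'n"  (\<open>_\<^sup>\<dagger>\<close> [1000] 999) where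
  "M\<^sup>\<dagger> = (THE X. is_mp_inverse M X)"

definition frobenius_norm :: "complex^'n^'m \<Rightarrow> real"  (\<open>\<parallel>_\<parallel>\<^sub>F\<close>) where
  "\<parallel>M\<parallel>\<^sub>F = sqrt (\<Sum>i\<in>UNIV. \<Sum>j\<in>UNIV. (cmod (M $ i $ j))\<^sup>2)"

(* Vectors carry the Euclidean norm, so this is the operator norm induced by it. *)
definition spectral_norm :: "complex^'n^'m \<Rightarrow> real"  (\<open>\<parallel>_\<parallel>\<^sub>2\<close>) where
  "\<parallel>M\<parallel>\<^sub>2 = onorm ((*v) M)"

definition range_proj :: "complex^'n^'m \<Rightarrow> complex^'m^'m" where
  "range_proj M = M ** M\<^sup>\<dagger>"

lemma frobenius_norm_eq_norm: "\<parallel>M\<parallel>\<^sub>F = norm M"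
  by (simp add: frobenius_norm_def norm_vec_def L2_set_def sum_nonneg)

lemma conj_transpose_conj_transpose [simp]: "conj_transpose (conj_transpose M) = M"
  by (simp add: conj_transpose_def map_matrix_def transpose_def vec_eq_iff)

lemma conj_transpose_mult:
  "conj_transpose (M ** N) = conj_transpose N ** conj_transpose M"
  by (simp add: conj_transpose_def map_matrix_def transpose_def matrix_matrix_mult_def
      vec_eq_iff mult.commute)

lemma inner_mult_conj_transpose:
  fixes M :: "complex^'n^'m"
  shows "(M *v x) \<bullet> y = x \<bullet> (conj_transpose M *v y)"
proof -
  have l: "(\<Sum>j\<in>UNIV. f j) \<bullet> b = (\<Sum>j\<in>UNIV. f j \<bullet> b)" for f :: "'n \<Rightarrow> complex" and b
    by (rule inner_sum_left)
  have c: "(a * b) \<bullet> d = b \<bullet> (cnj a * d)" for a b d :: complex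
    by (simp add: inner_complex_def algebra_simps)
  have "(M *v x) \<bullet> y = (\<Sum>i\<in>UNIV. \<Sum>j\<in>UNIV. x $ j \<bullet> (cnj (M $ i $ j) * y $ i))"
    by (simp only: inner_vec_def matrix_vector_mult_def vec_lambda_beta l c)
  also have "\<dots> = (\<Sum>j\<in>UNIV. \<Sum>i\<in>UNIV. x $ j \<bullet> (cnj (M $ i $ j) * y $ i))"
    by (rule sum.swap)
  also have "\<dots> = x \<bullet> (conj_transpose M *v y)"
    by (simp add: inner_vec_def matrix_vector_mult_def inner_sum_right
        conj_transpose_def map_matrix_def transpose_def)
  finally show ?thesis .
qed

lemma normal_equation_solvable:
  fixes M :: "complex^'n^'m"
  shows "\<exists>x. conj_transpose M *v (M *v x) = conj_transpose M *v b"
proof -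
  have lin: "linear ((*v) M)" by simp
  then have sub: "subspace (range ((*v) M))"
    by (simp add: linear_subspace_image)
  obtain y z where y: "y \<in> span (range ((*v) M))"
    and z: "\<And>w. w \<in> span (range ((*v) M)) \<Longrightarrow> orthogonal z w" and b: "b = y + z"
    using orthogonal_subspace_decomp_exists[of "range ((*v) M)" b] by metis
  obtain x where x: "y = M *v x"
    using y sub by (auto simp: span_eq_iff[THEN iffD2])
  have "(M *v (conj_transpose M *v z)) \<bullet> z = 0"
    using z[of "M *v (conj_transpose M *v z)"]
    by (simp add: orthogonal_def span_base inner_commute)
  then have "conj_transpose M *v z = 0"
    by (metis inner_mult_conj_transpose inner_eq_zero_iff)
  then have "conj_transpose M *v (M *v x) = conj_transpose M *v b"
    by (simp add: b x matrix_vector_right_distrib)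
  then show ?thesis ..
qed

lemma normal_equation_matrix:
  fixes M :: "complex^'n^'m"
  shows "\<exists>Z. conj_transpose M ** M ** Z = conj_transpose M"
proof -
  obtain g where g: "\<And>b. conj_transpose M *v (M *v g b) = conj_transpose M *v b"
    using normal_equation_solvable[of M] by metis
  define Z where "Z = (\<chi> i j. g (axis j 1) $ i)"
  have ax: "K *v axis j 1 = column j K" for K :: "complex^'p^'q" and j
    by (simp add: matrix_vector_mult_def axis_def column_def vec_eq_iff if_distrib cong: if_cong)
  have col: "Z *v axis j 1 = g (axis j 1)" for j
    by (simp add: ax) (simp add: Z_def column_def vec_eq_iff)
  have "column j (conj_transpose M ** M ** Z) = column j (conj_transpose M)" for j
    unfolding ax[symmetric]
    by (simp only: matrix_vector_mul_assoc[symmetric] col g)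
  then have "conj_transpose M ** M ** Z = conj_transpose M"
    by (simp add: column_def vec_eq_iff)
  then show ?thesis ..
qed

lemma hermitian_right_inverse:
  fixes M :: "complex^'n^'m"
  shows "\<exists>Z. M ** Z ** M = M \<and> conj_transpose (M ** Z) = M ** Z"
proof -
  obtain Z where Z: "conj_transpose M ** M ** Z = conj_transpose M"
    using normal_equation_matrix by blast
  have "conj_transpose (M ** Z) ** (M ** Z) = conj_transpose (M ** Z)"
    using Z by (simp add: conj_transpose_mult matrix_mul_assoc[symmetric])
  then have herm: "conj_transpose (M ** Z) = M ** Z"
    by (metis conj_transpose_mult conj_transpose_conj_transpose)
  have "M ** Z ** M = conj_transpose (conj_transpose M ** M ** Z)"
    using herm by (metis conj_transpose_mult conj_transpose_conj_transpose matrix_mul_assoc)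
  then show ?thesis
    using herm Z by auto
qed

lemma is_mp_inverse_unique:
  assumes X: "is_mp_inverse M X" and Y: "is_mp_inverse M Y"
  shows "X = Y"
proof -
  have "M ** X = conj_transpose (M ** Y ** (M ** X))"
    using X Y by (metis is_mp_inverse_def matrix_mul_assoc)
  also have "\<dots> = M ** X ** (M ** Y)"
    using X Y by (simp add: conj_transpose_mult[of "M ** Y"] is_mp_inverse_def)
  also have "\<dots> = M ** Y"
    using X by (simp add: is_mp_inverse_def matrix_mul_assoc)
  finally have 1: "M ** X = M ** Y" .
  have "X ** M = conj_transpose (X ** M ** (Y ** M))"
    using X Y by (metis is_mp_inverse_def matrix_mul_assoc)
  also have "\<dots> = Y ** M ** (X ** M)"
    using X Y by (simp add: conj_transpose_mult[of "X ** M"] is_mp_inverse_def)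
  also have "\<dots> = Y ** M"
    using X by (metis is_mp_inverse_def matrix_mul_assoc)
  finally have 2: "X ** M = Y ** M" .
  have "X = X ** (M ** X)"
    using X by (simp add: is_mp_inverse_def matrix_mul_assoc)
  also have "\<dots> = Y ** M ** Y"
    by (metis 1 2 matrix_mul_assoc)
  finally show ?thesis
    using Y by (simp add: is_mp_inverse_def)
qed

lemma ex_is_mp_inverse: "\<exists>X. is_mp_inverse M X"
proof -
  obtain Z where Z: "M ** Z ** M = M" "conj_transpose (M ** Z) = M ** Z"
    using hermitian_right_inverse by blast
  obtain W where W: "conj_transpose M ** W ** conj_transpose M = conj_transpose M"
      "conj_transpose (conj_transpose M ** W) = conj_transpose M ** W"
    using hermitian_right_inverse by blast
  define V where "V = conj_transpose W"
  have V: "M ** V ** M = M" "conj_transpose (V ** M) = V ** M"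
    using W unfolding V_def
    by (metis conj_transpose_mult conj_transpose_conj_transpose matrix_mul_assoc)+
  define X where "X = V ** M ** Z"
  have MX: "M ** X = M ** Z" and XM: "X ** M = V ** M"
    using V(1) Z(1) by (metis X_def matrix_mul_assoc)+
  have "X ** M ** X = X"
    by (metis XM X_def V(1) matrix_mul_assoc)
  then have "is_mp_inverse M X"
    using MX XM Z V by (simp add: is_mp_inverse_def)
  then show ?thesis ..
qed

lemma mp_inverse_ex1: "\<exists>!X. is_mp_inverse M X"
  using ex_is_mp_inverse is_mp_inverse_unique by blast

end

(* Write P and Q for the projections P_A and P_B. Splitting Q - P with Q gives
   ||Q - P||^2 = ||(1-Q)P||^2 + ||(1-P)Q||^2 in the Frobenius norm. Since (1-Q)B = 0, we have
   (1-Q)P = -(1-Q)E A^+, and since B^+(1-Q) = 0, the adjoint P(1-Q) equals -A E~ (1-Q); these two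
   factorisations bound the first term by beta_1, and the second is symmetric.
   Also ||(1-Q)P||^2 = ||P||^2 - ||QP||^2, where ||P||^2 = trace P depends only on the rank of A,
   so the two terms agree when the ranks do. *)
theory Submission
  imports Defs
begin

section \<open>Matrix arithmetic and the Frobenius inner product\<close>

lemma matrix_diff_ldistrib:
  fixes A :: "'a::ring_1^'n^'m"
  shows "A ** (B - C) = A ** B - A ** C"
  by (simp add: matrix_matrix_mult_def vec_eq_iff right_diff_distrib sum_subtractf)

lemma matrix_diff_rdistrib:
  fixes A :: "'a::ring_1^'n^'m"
  shows "(A - B) ** C = A ** C - B ** C"
  by (simp add: matrix_matrix_mult_def vec_eq_iff left_diff_distrib sum_subtractf)

lemma matrix_minus_mult:
  fixes A :: "'a::ring_1^'n^'m"
  shows "(- A) ** B = - (A ** B)"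
  by (simp add: matrix_matrix_mult_def vec_eq_iff sum_negf)

lemma matrix_mult_minus:
  fixes A :: "'a::ring_1^'n^'m"
  shows "A ** (- B) = - (A ** B)"
  by (simp add: matrix_matrix_mult_def vec_eq_iff sum_negf)

lemma conj_transpose_diff: "conj_transpose (M - N) = conj_transpose M - conj_transpose N"
  by (simp add: conj_transpose_def map_matrix_def transpose_def vec_eq_iff)

lemma inner_eq_sum_columns:
  fixes X Y :: "complex^'n^'m"
  shows "X \<bullet> Y = (\<Sum>j\<in>UNIV. column j X \<bullet> column j Y)"
  unfolding inner_vec_def column_def vec_lambda_beta by (rule sum.swap)

lemma column_matrix_mult: "column j (A ** B) = A *v column j B"
  by (simp add: column_def matrix_matrix_mult_def matrix_vector_mult_def vec_eq_iff)

text \<open>Working column by column turns the adjoint rule for vectors into one for matrices. Here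
  the inner product is the real part of the Frobenius inner product.\<close>

lemma inner_matrix_mult:
  fixes M :: "complex^'n^'m"
  shows "(M ** X) \<bullet> Y = X \<bullet> (conj_transpose M ** Y)"
  by (simp add: inner_eq_sum_columns column_matrix_mult inner_mult_conj_transpose)

lemma inner_conj_transpose:
  "conj_transpose X \<bullet> conj_transpose Y = X \<bullet> Y"
proof -
  have "conj_transpose X \<bullet> conj_transpose Y = (\<Sum>j\<in>UNIV. \<Sum>i\<in>UNIV. X $ i $ j \<bullet> Y $ i $ j)"
    by (simp add: conj_transpose_def map_matrix_def transpose_def inner_vec_def inner_complex_def)
  also have "\<dots> = X \<bullet> Y"
    unfolding inner_vec_def by (rule sum.swap)
  finally show ?thesis .
qed

lemma norm_conj_transpose [simp]: "norm (conj_transpose X) = norm X"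
  by (simp add: norm_eq_sqrt_inner inner_conj_transpose)

text \<open>The squared Frobenius norm is the sum of the squared column norms, and \<open>M\<close>
  acts on each column of \<open>X\<close> separately.\<close>

lemma norm_matrix_mult_le:
  fixes M :: "complex^'n^'m"
  shows "(norm (M ** X))\<^sup>2 \<le> \<parallel>M\<parallel>\<^sub>2\<^sup>2 * (norm X)\<^sup>2"
proof -
  have "norm (M *v v) \<le> \<parallel>M\<parallel>\<^sub>2 * norm v" for v
    unfolding spectral_norm_def by (rule onorm) simp
  then have "(norm (M *v v))\<^sup>2 \<le> \<parallel>M\<parallel>\<^sub>2\<^sup>2 * (norm v)\<^sup>2" for v
    by (metis norm_ge_zero power_mono power_mult_distrib)
  then show ?thesis
    by (simp add: power2_norm_eq_inner inner_eq_sum_columns column_matrix_mult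
        sum_distrib_left sum_mono)
qed

text \<open>With w the image of v under the adjoint of \<open>M\<close>, Cauchy-Schwarz bounds the
  square of |w| by |Mw||v|, and one factor |w| cancels. This lets the product bound pass to right
  factors.\<close>

lemma spectral_norm_conj_transpose_le: "\<parallel>conj_transpose M\<parallel>\<^sub>2 \<le> \<parallel>M\<parallel>\<^sub>2"
proof -
  have "norm (conj_transpose M *v v) \<le> \<parallel>M\<parallel>\<^sub>2 * norm v" for v
  proof -
    have "(norm (conj_transpose M *v v))\<^sup>2 = (M *v (conj_transpose M *v v)) \<bullet> v"
      by (simp add: power2_norm_eq_inner inner_mult_conj_transpose)
    also have "\<dots> \<le> norm (M *v (conj_transpose M *v v)) * norm v"
      by (rule norm_cauchy_schwarz)
    also have "\<dots> \<le> \<parallel>M\<parallel>\<^sub>2 * norm (conj_transpose M *v v) * norm v"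
      unfolding spectral_norm_def
      by (intro mult_right_mono onorm) simp_all
    finally have "norm (conj_transpose M *v v) * norm (conj_transpose M *v v)
        \<le> norm (conj_transpose M *v v) * (\<parallel>M\<parallel>\<^sub>2 * norm v)"
      by (simp add: power2_eq_square mult_ac)
    \<comment> \<open>This covers the case where the factor to be cancelled is zero.\<close>
    moreover have "0 \<le> \<parallel>M\<parallel>\<^sub>2 * norm v"
      unfolding spectral_norm_def by (simp add: onorm_pos_le)
    ultimately show ?thesis
      by (metis mult_le_cancel_left_pos norm_ge_zero order_le_less)
  qed
  then show ?thesis
    unfolding spectral_norm_def by (rule onorm_bound[rotated]) (simp add: onorm_pos_le)
qed

lemma norm_matrix_mult_le':
  fixes X :: "complex^'n^'m"
  shows "(norm (X ** M))\<^sup>2 \<le> \<parallel>M\<parallel>\<^sub>2\<^sup>2 * (norm X)\<^sup>2"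
proof -
  have "(norm (X ** M))\<^sup>2 = (norm (conj_transpose M ** conj_transpose X))\<^sup>2"
    by (metis norm_conj_transpose conj_transpose_mult)
  also have "\<dots> \<le> \<parallel>conj_transpose M\<parallel>\<^sub>2\<^sup>2 * (norm X)\<^sup>2"
    using norm_matrix_mult_le[of "conj_transpose M" "conj_transpose X"] by simp
  also have "\<dots> \<le> \<parallel>M\<parallel>\<^sub>2\<^sup>2 * (norm X)\<^sup>2"
    using spectral_norm_conj_transpose_le[of M]
    by (intro mult_right_mono power_mono) (simp_all add: spectral_norm_def onorm_pos_le)
  finally show ?thesis .
qed

section \<open>Orthogonal projections: Pythagoras and the trace\<close>

definition is_orth_proj :: "complex^'m^'m \<Rightarrow> bool" where
  "is_orth_proj P \<longleftrightarrow> P ** P = P \<and> conj_transpose P = P"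

text \<open>Pythagoras: \<open>Q\<close> is self-adjoint and idempotent, so the cross term of
  \<open>X\<close> and \<open>Q ** X\<close> equals the squared norm of
  \<open>Q ** X\<close>.\<close>

lemma norm_minus_orth_proj_mult:
  assumes "is_orth_proj Q"
  shows "(norm (X - Q ** X))\<^sup>2 = (norm X)\<^sup>2 - (norm (Q ** X))\<^sup>2"
proof -
  have "(Q ** X) \<bullet> (Q ** X) = X \<bullet> (Q ** X)"
    using assms by (simp add: inner_matrix_mult is_orth_proj_def matrix_mul_assoc)
  then show ?thesis
    by (simp add: power2_norm_eq_inner inner_diff_left inner_diff_right inner_commute)
qed

lemma norm_minus_mult_orth_proj:
  assumes "is_orth_proj Q"
  shows "(norm (X - X ** Q))\<^sup>2 = (norm X)\<^sup>2 - (norm (X ** Q))\<^sup>2"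
proof -
  have "X ** Q = conj_transpose (Q ** conj_transpose X)"
    using assms by (simp add: conj_transpose_mult is_orth_proj_def)
  moreover from this have "X - X ** Q = conj_transpose (conj_transpose X - Q ** conj_transpose X)"
    by (simp add: conj_transpose_diff)
  ultimately show ?thesis
    using norm_minus_orth_proj_mult[OF assms, of "conj_transpose X"]
    by (simp only: norm_conj_transpose)
qed

lemma norm_orth_proj_mult_commute:
  assumes "is_orth_proj P" "is_orth_proj Q"
  shows "norm (P ** Q) = norm (Q ** P)"
  using assms norm_conj_transpose[of "P ** Q"] by (simp add: conj_transpose_mult is_orth_proj_def)

lemma norm_orth_proj_diff:
  assumes P: "is_orth_proj P" and Q: "is_orth_proj Q"
  shows "(norm (Q - P))\<^sup>2 = (norm (P - Q ** P))\<^sup>2 + (norm (Q - P ** Q))\<^sup>2"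
proof -
  \<comment> \<open>The \<open>Q\<close> component of the difference is Q - QP, whose adjoint is Q -
    PQ; the Frobenius norm does not see the adjoint.\<close>
  have 1: "Q ** (Q - P) = conj_transpose (Q - P ** Q)"
    using P Q by (simp add: conj_transpose_diff conj_transpose_mult matrix_diff_ldistrib is_orth_proj_def)
  have "(Q - P) - Q ** (Q - P) = - (P - Q ** P)"
    using Q by (simp add: matrix_diff_ldistrib is_orth_proj_def)
  then have "norm ((Q - P) - Q ** (Q - P)) = norm (P - Q ** P)"
    by (metis norm_minus_cancel)
  moreover have "norm (Q ** (Q - P)) = norm (Q - P ** Q)"
    by (simp only: 1 norm_conj_transpose)
  ultimately show ?thesis
    using norm_minus_orth_proj_mult[OF Q, of "Q - P"] by simp
qed

text \<open>Writing P as P times the identity lets one factor P move across the inner product, where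
  idempotence absorbs it.\<close>

lemma norm_orth_proj:
  assumes "is_orth_proj P"
  shows "(norm P)\<^sup>2 = Re (trace P)"
proof -
  have "(norm P)\<^sup>2 = (P ** mat 1) \<bullet> (P ** mat 1)"
    by (simp add: power2_norm_eq_inner)
  also have "\<dots> = mat 1 \<bullet> P"
    using assms by (simp only: inner_matrix_mult) (simp add: is_orth_proj_def)
  also have "\<dots> = Re (trace P)"
    by (simp add: inner_vec_def mat_def trace_def inner_complex_def if_distrib[of Re]
        if_distrib[of Im] if_distrib[of "\<lambda>x. x * _"] cong: if_cong)
  finally show ?thesis .
qed

section \<open>Equal rank gives equal trace\<close>

lemma span_rows_eq_range_transpose:
  fixes M :: "'a::field^'n^'m"
  shows "vec.span (rows M) = range ((*v) (transpose M))"
proof -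
  have *: "row i M = transpose M *v axis i 1" for i
    by (simp add: row_def transpose_def matrix_vector_mult_def axis_def vec_eq_iff if_distrib cong: if_cong)
  have "rows M \<subseteq> range ((*v) (transpose M))"
    by (auto simp: rows_def *)
  then have "vec.span (rows M) \<subseteq> range ((*v) (transpose M))"
    by (intro vec.span_minimal vec.subspace_image vec.subspace_UNIV)
  moreover have "transpose M *v x \<in> vec.span (rows M)" for x
    by (metis matrix_vector_mult_in_columnspace_gen columns_transpose)
  ultimately show ?thesis by auto
qed

text \<open>The library defines the rank as the row rank, so the isomorphism is taken between the row
  spaces: it yields K and L with LK and KL the transposes of XM and YN, which therefore have equal
  traces.\<close>

lemma rank_eq_imp_trace_eq:
  fixes M N :: "'a::field^'n^'m"
  assumes M: "M ** X ** M = M" and N: "N ** Y ** N = N" and rank: "rank M = rank N"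
  shows "trace (M ** X) = trace (N ** Y)"
proof -
  define S T where "S = vec.span (rows M)" and "T = vec.span (rows N)"
  define P Q where "P = transpose (X ** M)" and "Q = transpose (Y ** N)"
  have "transpose M ** transpose X ** transpose M = transpose M"
       "transpose N ** transpose Y ** transpose N = transpose N"
    using M N by (metis matrix_transpose_mul matrix_mul_assoc)+
  \<comment> \<open>\<open>P\<close> and \<open>Q\<close> are idempotents with ranges
    \<open>S\<close> and \<open>T\<close>: the transposed inverse equations make them fix these
    spaces pointwise.\<close>
  then have P: "v \<in> S \<Longrightarrow> P *v v = v" and Q: "v \<in> T \<Longrightarrow> Q *v v = v" for v
    unfolding S_def T_def P_def Q_def span_rows_eq_range_transpose matrix_transpose_mul
    by (auto simp: matrix_vector_mul_assoc simp del: transpose_matrix_vector)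
  have PS: "P *v v \<in> S" and QT: "Q *v v \<in> T" for v
    unfolding S_def T_def P_def Q_def span_rows_eq_range_transpose matrix_transpose_mul
    by (auto simp: matrix_vector_mul_assoc[symmetric] simp del: transpose_matrix_vector)
  have "vec.dim S = vec.dim T"
    using rank by (simp add: S_def T_def row_rank_def_gen)
  then obtain f where f: "Vector_Spaces.linear (*s) (*s) f" "f ` S = T" "inj_on f S"
    using vec.subspace_isomorphism[of S T] by (auto simp: S_def T_def)
  obtain g where g: "Vector_Spaces.linear (*s) (*s) g" "\<forall>v\<in>S. g (f v) = v"
    using vec.linear_exists_left_inverse_on[OF f(1) _ f(3)] S_def by auto
  define K L where "K = matrix f ** P" and "L = matrix g ** Q"
  have K: "K *v v = f (P *v v)" and L: "L *v v = g (Q *v v)" for v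
    using f(1) g(1) by (simp_all add: K_def L_def matrix_works flip: matrix_vector_mul_assoc)
  \<comment> \<open>\<open>f\<close> sends \<open>P *v v\<close> into \<open>T\<close>, where
    \<open>Q\<close> is the identity, and \<open>g\<close> then undoes \<open>f\<close>.\<close>
  have "(L ** K) *v v = P *v v" for v
    using PS[of v] Q f(2) g(2) by (auto simp: K L simp flip: matrix_vector_mul_assoc)
  then have "L ** K = P"
    by (simp add: matrix_eq)
  moreover have "(K ** L) *v v = Q *v v" for v
  proof -
    \<comment> \<open>\<open>g\<close> inverts \<open>f\<close> only on \<open>S\<close>, so
      surjectivity of \<open>f\<close> onto \<open>T\<close> is used to write \<open>Q *v v\<close>
      as an image from \<open>S\<close>.\<close>
    obtain u where "u \<in> S" "Q *v v = f u"
      using QT[of v] f(2) by auto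
    then show ?thesis
      using P g(2) by (simp add: K L flip: matrix_vector_mul_assoc)
  qed
  then have "K ** L = Q"
    by (simp add: matrix_eq)
  ultimately have "trace P = trace Q"
    using trace_mul_sym by metis
  then have "trace (X ** M) = trace (Y ** N)"
    by (simp add: P_def Q_def trace_def transpose_def)
  then show ?thesis
    by (simp only: trace_mul_sym[of M] trace_mul_sym[of N])
qed

section \<open>Range projections and the residual bounds\<close>

lemma is_mp_inverse_mp_inverse: "is_mp_inverse M (M\<^sup>\<dagger>)"
  unfolding mp_inverse_def using mp_inverse_ex1 by (rule theI')

lemma is_orth_proj_range_proj: "is_orth_proj (range_proj M)"
  using is_mp_inverse_mp_inverse[of M]
  by (simp add: is_orth_proj_def range_proj_def is_mp_inverse_def matrix_mul_assoc)

lemma range_proj_mult: "range_proj M ** M = M"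
  using is_mp_inverse_mp_inverse[of M] by (simp add: range_proj_def is_mp_inverse_def)

lemma mp_inverse_mult_range_proj: "M\<^sup>\<dagger> ** range_proj M = M\<^sup>\<dagger>"
  using is_mp_inverse_mp_inverse[of M]
  by (simp add: range_proj_def is_mp_inverse_def matrix_mul_assoc)

lemma norm_range_proj_eq:
  fixes A B :: "complex^'n^'m"
  assumes "rank A = rank B"
  shows "norm (range_proj A) = norm (range_proj B)"
proof -
  have "trace (range_proj A) = trace (range_proj B)"
    unfolding range_proj_def
    by (rule rank_eq_imp_trace_eq[OF _ _ assms]) (metis range_proj_def range_proj_mult)+
  then have "(norm (range_proj A))\<^sup>2 = (norm (range_proj B))\<^sup>2"
    by (simp add: norm_orth_proj is_orth_proj_range_proj)
  then show ?thesis by simp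
qed

lemma range_proj_residual_le:
  fixes A B E :: "complex^'n^'m"
  assumes E: "E = B - A \<or> E = A - B"
  shows "(norm (range_proj A - range_proj B ** range_proj A))\<^sup>2
      \<le> \<parallel>A\<^sup>\<dagger>\<parallel>\<^sub>2\<^sup>2 * ((norm E)\<^sup>2 - (norm (range_proj B ** E))\<^sup>2)"
proof -
  let ?Q = "range_proj B"
  have "E - ?Q ** E = - (A - ?Q ** A) \<or> E - ?Q ** E = A - ?Q ** A"
    using E by (elim disjE) (simp_all add: matrix_diff_ldistrib range_proj_mult)
  moreover have "(A - ?Q ** A) ** A\<^sup>\<dagger> = range_proj A - ?Q ** range_proj A"
    by (simp only: matrix_diff_rdistrib range_proj_def matrix_mul_assoc)
  ultimately have "norm (range_proj A - ?Q ** range_proj A) = norm ((E - ?Q ** E) ** A\<^sup>\<dagger>)"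
    by (elim disjE) (simp_all only: matrix_minus_mult norm_minus_cancel)
  then show ?thesis
    using norm_matrix_mult_le'[of "E - ?Q ** E" "A\<^sup>\<dagger>"]
    by (simp add: norm_minus_orth_proj_mult is_orth_proj_range_proj)
qed

text \<open>The dual factorisation: 1 - Q annihilates the inverse of \<open>B\<close> from the
  right, so E(1 - Q) is, up to sign, the inverse of \<open>A\<close> times 1 - Q, and multiplying by
  \<open>A\<close> on the left gives P(1 - Q).\<close>

lemma range_proj_residual_le':
  fixes A B :: "complex^'n^'m"
  assumes E: "E = B\<^sup>\<dagger> - A\<^sup>\<dagger> \<or> E = A\<^sup>\<dagger> - B\<^sup>\<dagger>"
  shows "(norm (range_proj A - range_proj B ** range_proj A))\<^sup>2
      \<le> \<parallel>A\<parallel>\<^sub>2\<^sup>2 * ((norm E)\<^sup>2 - (norm (E ** range_proj B))\<^sup>2)"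
proof -
  let ?P = "range_proj A" and ?Q = "range_proj B"
  \<comment> \<open>Passing to the adjoint puts P on the left, where the factor \<open>A\<close> can
    be split off.\<close>
  have "norm (?P - ?Q ** ?P) = norm (?P - ?P ** ?Q)"
    using is_orth_proj_range_proj[of A] is_orth_proj_range_proj[of B]
      norm_conj_transpose[of "?P - ?P ** ?Q"]
    by (simp add: conj_transpose_diff conj_transpose_mult is_orth_proj_def)
  also have "\<dots> = norm (A ** (E - E ** ?Q))"
  proof -
    have "E - E ** ?Q = - (A\<^sup>\<dagger> - A\<^sup>\<dagger> ** ?Q) \<or> E - E ** ?Q = A\<^sup>\<dagger> - A\<^sup>\<dagger> ** ?Q"
      using E by (elim disjE) (simp_all add: matrix_diff_rdistrib mp_inverse_mult_range_proj)
    moreover have "A ** (A\<^sup>\<dagger> - A\<^sup>\<dagger> ** ?Q) = ?P - ?P ** ?Q"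
      by (simp only: matrix_diff_ldistrib range_proj_def matrix_mul_assoc)
    ultimately show ?thesis
      by (elim disjE) (simp_all only: matrix_mult_minus norm_minus_cancel)
  qed
  finally show ?thesis
    using norm_matrix_mult_le[of A "E - E ** ?Q"]
    by (simp add: norm_minus_mult_orth_proj is_orth_proj_range_proj)
qed

theorem theorem3p3:
  fixes A B E :: "complex^'n^'m" and Et :: "complex^'m^'n"
    and r s :: nat and \<beta>1 \<beta>2 :: real
  assumes "rank A = r" and "r \<ge> 1"
    and "rank B = s" and "s \<ge> 1"
    and "E = B - A" and "Et = B\<^sup>\<dagger> - A\<^sup>\<dagger>"
    and "\<beta>1 = min (\<parallel>A\<^sup>\<dagger>\<parallel>\<^sub>2\<^sup>2 * (\<parallel>E\<parallel>\<^sub>F\<^sup>2 - \<parallel>B ** B\<^sup>\<dagger> ** E\<parallel>\<^sub>F\<^sup>2))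
                  (\<parallel>A\<parallel>\<^sub>2\<^sup>2 * (\<parallel>Et\<parallel>\<^sub>F\<^sup>2 - \<parallel>Et ** B ** B\<^sup>\<dagger>\<parallel>\<^sub>F\<^sup>2))"
    and "\<beta>2 = min (\<parallel>B\<^sup>\<dagger>\<parallel>\<^sub>2\<^sup>2 * (\<parallel>E\<parallel>\<^sub>F\<^sup>2 - \<parallel>A ** A\<^sup>\<dagger> ** E\<parallel>\<^sub>F\<^sup>2))
                  (\<parallel>B\<parallel>\<^sub>2\<^sup>2 * (\<parallel>Et\<parallel>\<^sub>F\<^sup>2 - \<parallel>Et ** A ** A\<^sup>\<dagger>\<parallel>\<^sub>F\<^sup>2))"
  shows "\<parallel>range_proj B - range_proj A\<parallel>\<^sub>F\<^sup>2 \<le> \<beta>1 + \<beta>2 \<and>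
         (s = r \<longrightarrow> \<parallel>range_proj B - range_proj A\<parallel>\<^sub>F\<^sup>2 \<le> 2 * min \<beta>1 \<beta>2)"
proof -
  let ?P = "range_proj A" and ?Q = "range_proj B"
  let ?a = "(norm (?P - ?Q ** ?P))\<^sup>2" and ?b = "(norm (?Q - ?P ** ?Q))\<^sup>2"
  have a: "?a \<le> \<beta>1"
    unfolding assms(7) frobenius_norm_eq_norm
    using range_proj_residual_le[of E B A, OF disjI1, OF assms(5)]
      range_proj_residual_le'[of Et B A, OF disjI1, OF assms(6)]
    by (simp only: range_proj_def matrix_mul_assoc min.bounded_iff conj_absorb)
  have b: "?b \<le> \<beta>2"
    unfolding assms(8) frobenius_norm_eq_norm
    \<comment> \<open>With \<open>A\<close> and \<open>B\<close> exchanged, the differences have the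
      opposite sign, hence the second disjunct.\<close>
    using range_proj_residual_le[of E A B, OF disjI2, OF assms(5)]
      range_proj_residual_le'[of Et A B, OF disjI2, OF assms(6)]
    by (simp only: range_proj_def matrix_mul_assoc min.bounded_iff conj_absorb)
  have sum: "\<parallel>?Q - ?P\<parallel>\<^sub>F\<^sup>2 = ?a + ?b"
    unfolding frobenius_norm_eq_norm
    by (intro norm_orth_proj_diff is_orth_proj_range_proj)
  have "?a = ?b" if "s = r"
  proof -
    have "norm ?P = norm ?Q"
      using that assms(1,3) by (intro norm_range_proj_eq) simp
    moreover have "norm (?Q ** ?P) = norm (?P ** ?Q)"
      by (intro norm_orth_proj_mult_commute is_orth_proj_range_proj)
    ultimately show ?thesis
      by (simp only: norm_minus_orth_proj_mult[OF is_orth_proj_range_proj])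
  qed
  \<comment> \<open>When \<open>?a = ?b\<close>, their sum is twice either one, so it is at most
    twice each of the two bounds.\<close>
  then show ?thesis
    unfolding sum using a b by linarith
qed

end
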